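(* There exists a $(108,10,1)$-difference matrix over the additive group of $\mathrm{GF}(4)\times \mathrm{GF}(27)$.
   Context: Let $G$ be a finite abelian group of order $n$, written additively, and let $k\ge 2$ be an integer. An $(n,k,1)$-difference matrix over $G$ is a $k\times n$ matrix $D=(d_{i,j})$ with entries from $G$ such that for any two distinct rows $s$ and $t$, the multiset of differences $\{d_{s,j}-d_{t,j} : 1\le j\le n\}$ contains each element of $G$ exactly once. $\mathrm{GF}(q)$ denotes the finite field with $q$ elements. *)

theory Defs
  imports "HOL-Algebra.Chinese_Remainder" "HOL-Library.Multiset"
begin

text \<open>
  HOL-Algebra groups are written multiplicatively, so the difference \<open>d - d'\<close> in \<open>G\<close> is
  \<open>d \<otimes> inv d'\<close>; for \<open>G = add_monoid R\<close> this is the subtraction \<open>d \<ominus> d'\<close> of the ring \<open>R\<close>.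
  Rows and columns are indexed from 0, and entries of \<open>D\<close> outside \<open>{..<k} \<times> {..<n}\<close> are ignored.
\<close>

definition difference_matrix ::
    "('a, 'm) monoid_scheme \<Rightarrow> nat \<Rightarrow> nat \<Rightarrow> (nat \<Rightarrow> nat \<Rightarrow> 'a) \<Rightarrow> bool" where
  "difference_matrix G n k D \<longleftrightarrow>
     comm_group G \<and> finite (carrier G) \<and> order G = n \<and> 2 \<le> k \<and>
     (\<forall>i<k. \<forall>j<n. D i j \<in> carrier G) \<and>
     (\<forall>s<k. \<forall>t<k. s \<noteq> t \<longrightarrow>
        (\<forall>g\<in>carrier G.
           count {# D s j \<otimes>\<^bsub>G\<^esub> inv\<^bsub>G\<^esub> D t j. j \<in># mset_set {..<n} #} g = 1))"

text \<open>
  \<open>GF(q)\<close> is rendered as an arbitrary field of order \<open>q\<close> (it is unique up to isomorphism).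
  Models for \<open>q = 4\<close> and \<open>q = 27\<close> show that such fields exist: the residues of integer
  polynomials modulo \<open>(2, x\<^sup>2 + x + 1)\<close> and \<open>(3, x\<^sup>3 - x - 1)\<close>, as coefficient tuples in
  ascending order of degree.
\<close>

definition gf4_model :: "(int \<times> int) ring" where
  "gf4_model = \<lparr>carrier = {0..<2} \<times> {0..<2},
     monoid.mult = (\<lambda>(a, b) (c, d). ((a * c + b * d) mod 2, (a * d + b * c + b * d) mod 2)),
     one = (1, 0), ring.zero = (0, 0),
     ring.add = (\<lambda>(a, b) (c, d). ((a + c) mod 2, (b + d) mod 2))\<rparr>"

definition gf27_model :: "(int \<times> int \<times> int) ring" where
  "gf27_model = \<lparr>carrier = {0..<3} \<times> {0..<3} \<times> {0..<3},
     monoid.mult = (\<lambda>(a, b, c) (d, e, f).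
       ((a * d + b * f + c * e) mod 3,
        (a * e + b * d + b * f + c * e + c * f) mod 3,
        (a * f + b * e + c * d + c * f) mod 3)),
     one = (1, 0, 0), ring.zero = (0, 0, 0),
     ring.add = (\<lambda>(a, b, c) (d, e, f). ((a + d) mod 3, (b + e) mod 3, (c + f) mod 3))\<rparr>"

lemma gf4_model: "field gf4_model" "order gf4_model = 4"
proof -
  have neg: "\<exists>x\<in>{0..<2}. (a + x) mod 2 = 0" for a :: int
    by (rule bexI[of _ "- a mod 2"]) (auto simp: mod_simps)
  have bits: "x = 0 \<or> x = 1" if "x \<in> {0..<2}" for x :: int using that by auto
  have ab: "abelian_group gf4_model"
    by (rule abelian_groupI)
       (auto simp: gf4_model_def mod_simps algebra_simps neg)
  have absorb: "((A mod 2) * c + (B mod 2) * d) mod 2 = (A * c + B * d) mod 2"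
    "((A mod 2) * d + (B mod 2) * c + (B mod 2) * d) mod 2 = (A * d + B * c + B * d) mod 2"
    "(a * (C mod 2) + b * (D mod 2)) mod 2 = (a * C + b * D) mod 2"
    "(a * (D mod 2) + b * (C mod 2) + b * (D mod 2)) mod 2 = (a * D + b * C + b * D) mod 2"
    for a b c d A B C D :: int
    by (intro mod_add_cong mod_mult_cong; simp)+
  have cm: "comm_monoid gf4_model"
    by (rule comm_monoidI)
       (auto simp: gf4_model_def absorb, (simp add: algebra_simps)+)
  have "cring gf4_model"
    by (rule cringI[OF ab cm])
       (auto simp: gf4_model_def absorb, (simp only: mod_add_eq, simp add: algebra_simps)+)
  then interpret cring gf4_model .
  show "field gf4_model"
  proof (rule cring_fieldI2)
    show "\<zero>\<^bsub>gf4_model\<^esub> \<noteq> \<one>\<^bsub>gf4_model\<^esub>" by (simp add: gf4_model_def)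
    fix p assume p: "p \<in> carrier gf4_model" "p \<noteq> \<zero>\<^bsub>gf4_model\<^esub>"
    then obtain a b where ab: "p = (a, b)" "a \<in> {0..<2}" "b \<in> {0..<2}" "(a, b) \<noteq> (0, 0)"
      by (cases p) (auto simp: gf4_model_def)
    show "\<exists>q\<in>carrier gf4_model. p \<otimes>\<^bsub>gf4_model\<^esub> q = \<one>\<^bsub>gf4_model\<^esub>"
      \<comment> \<open>the inverse of \<open>a + bx\<close> is its square \<open>(a + b) + bx\<close>\<close>
      using bits[OF ab(2)] bits[OF ab(3)] ab(4) unfolding ab(1)
      by (intro bexI[of _ "((a + b) mod 2, b)"]) (auto simp: gf4_model_def)
  qed
  show "order gf4_model = 4" by (simp add: order_def gf4_model_def)
qed

lemma gf27_model: "field gf27_model" "order gf27_model = 27"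
proof -
  have neg: "\<exists>x\<in>{0..<3}. (a + x) mod 3 = 0" for a :: int
    by (rule bexI[of _ "- a mod 3"]) (auto simp: mod_simps)
  have trits: "{0..<3} = set [0, 1, 2 :: int]" by auto
  have ab: "abelian_group gf27_model"
    by (rule abelian_groupI)
       (auto simp: gf27_model_def mod_simps algebra_simps neg)
  have absorb: "((A mod 3) * d + (B mod 3) * f + (C mod 3) * e) mod 3 = (A * d + B * f + C * e) mod 3"
    "((A mod 3) * e + (B mod 3) * d + (B mod 3) * f + (C mod 3) * e + (C mod 3) * f) mod 3 = (A * e + B * d + B * f + C * e + C * f) mod 3"
    "((A mod 3) * f + (B mod 3) * e + (C mod 3) * d + (C mod 3) * f) mod 3 = (A * f + B * e + C * d + C * f) mod 3"
    "(a * (D mod 3) + b * (F mod 3) + c * (E mod 3)) mod 3 = (a * D + b * F + c * E) mod 3"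
    "(a * (E mod 3) + b * (D mod 3) + b * (F mod 3) + c * (E mod 3) + c * (F mod 3)) mod 3 = (a * E + b * D + b * F + c * E + c * F) mod 3"
    "(a * (F mod 3) + b * (E mod 3) + c * (D mod 3) + c * (F mod 3)) mod 3 = (a * F + b * E + c * D + c * F) mod 3"
    for a b c d e f A B C D E F :: int
    by (intro mod_add_cong mod_mult_cong; simp)+
  have cm: "comm_monoid gf27_model"
    by (rule comm_monoidI)
       (auto simp: gf27_model_def absorb, (simp add: algebra_simps)+)
  have "cring gf27_model"
    by (rule cringI[OF ab cm])
       (auto simp: gf27_model_def absorb, (simp only: mod_add_eq, simp add: algebra_simps)+)
  then interpret cring gf27_model .
  show "field gf27_model"
  proof (rule cring_fieldI2)
    show "\<zero>\<^bsub>gf27_model\<^esub> \<noteq> \<one>\<^bsub>gf27_model\<^esub>" by (simp add: gf27_model_def)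
    fix p assume p: "p \<in> carrier gf27_model" "p \<noteq> \<zero>\<^bsub>gf27_model\<^esub>"
    have "\<forall>p\<in>set (List.product [0, 1, 2] (List.product [0, 1, 2] [0, 1, 2])). p \<noteq> (0, 0, 0) \<longrightarrow>
        (\<exists>q\<in>set (List.product [0, 1, 2] (List.product [0, 1, 2] [0, 1, 2])).
          p \<otimes>\<^bsub>gf27_model\<^esub> q = (1, 0, 0))"
      unfolding gf27_model_def by code_simp
    moreover have zero_one: "\<zero>\<^bsub>gf27_model\<^esub> = (0, 0, 0)" "\<one>\<^bsub>gf27_model\<^esub> = (1, 0, 0)"
      by (simp_all add: gf27_model_def)
    moreover have carr: "carrier gf27_model =
        set (List.product [0, 1, 2] (List.product [0, 1, 2] [0, 1, 2]))"
      by (simp only: gf27_model_def partial_object.simps trits set_product)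
    ultimately show "\<exists>q\<in>carrier gf27_model. p \<otimes>\<^bsub>gf27_model\<^esub> q = \<one>\<^bsub>gf27_model\<^esub>"
      using p unfolding carr zero_one by blast
  qed
  show "order gf27_model = 27" by (simp add: order_def gf27_model_def)
qed

end

theory Submission
  imports Defs "HOL-Algebra.Multiplicative_Group" "HOL-Computational_Algebra.Primes"
    "HOL-Library.Product_Plus"
begin

text \<open>
  The matrix has an automorphism group of order 9, which leaves only 12 columns to be exhibited.
  View \<open>GF(27)\<close> as \<open>\<int>[x]/(3, x\<^sup>3 - x - 1)\<close>, let \<open>W\<close> be the plane spanned by \<open>1\<close> and \<open>x\<close> over
  \<open>GF(3)\<close>, and attach to the rows ten distinct elements \<open>a\<^sub>s\<close> of \<open>GF(27)\<close>.  From a base column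
  with entries \<open>(y\<^sub>s, z\<^sub>s)\<close> form the nine columns \<open>(y\<^sub>s, z\<^sub>s + a\<^sub>s w)\<close>, \<open>w \<in> W\<close>.  The differences of
  rows \<open>s\<close> and \<open>t\<close> in these columns are exactly the coset of \<open>0 \<times> (a\<^sub>s - a\<^sub>t) W\<close> through the
  difference in the base column.  So the rows have the required property if and only if the 12 base
  differences lie in different cosets of that subgroup, whose quotient has order \<open>108 / 9 = 12\<close>.

  The coset of \<open>(y, z)\<close> is named by \<open>y\<close> together with the determinant of \<open>a\<^sub>s - a\<^sub>t\<close>,
  \<open>(a\<^sub>s - a\<^sub>t) x\<close> and \<open>z\<close> modulo 3.  Hence a pair of rows is good if these 12 names are distinct,
  which is a finite computation for the tables below (\<open>base_columns\<close>); \<open>entries_injective\<close> turns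
  the names back into a statement on all 108 columns.

  The tables themselves arise as follows.  The \<open>GF(4)\<close> parts of the base columns must form a matrix
  in which the differences of any two rows take each value three times, and ten rows of a generalized
  Hadamard matrix of order 12 over the Klein four-group serve for this.  Once they are fixed, the
  three columns sharing a value of \<open>y\<^sub>s - y\<^sub>t\<close> must have pairwise different determinants, that is,
  determinants with sum zero whose first two members differ.  This is a system of 180 linear
  equations over \<open>GF(3)\<close> for the \<open>GF(27)\<close> parts together with 180 conditions that a linear form
  does not vanish.  On the solution space these forms have rank 118, so 118 of their values can be
  prescribed freely, and the choice only has to avoid zeros of the remaining 62 forms.

  Only the additive groups of the two fields enter.  They are elementary abelian, so integer vectors
  serve as coordinates modulo 2 and modulo 3 (\<open>additive_basis\<close>), and the difference condition
  becomes an injectivity statement on integer tables (\<open>difference_matrixI\<close>).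
\<close>

section \<open>Coordinates in elementary abelian groups\<close>

text \<open>
  Coefficients are integers rather than residues, so that coordinates add and subtract without
  reduction; divisibility by the exponent \<open>p\<close> takes the place of vanishing.
\<close>
fun lincomb :: "('a, 'm) monoid_scheme \<Rightarrow> 'a list \<Rightarrow> int list \<Rightarrow> 'a" where
  "lincomb G (b # bs) (c # cs) = b [^]\<^bsub>G\<^esub> c \<otimes>\<^bsub>G\<^esub> lincomb G bs cs"
| "lincomb G _ _ = \<one>\<^bsub>G\<^esub>"

context comm_group
begin

lemma lincomb_closed [simp]:
  "set bs \<subseteq> carrier G \<Longrightarrow> lincomb G bs cs \<in> carrier G"
  by (induction bs arbitrary: cs; case_tac cs) auto

lemma lincomb_diff:
  assumes "set bs \<subseteq> carrier G" "length cs = length ds"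
  shows "lincomb G bs (map2 (-) cs ds) = lincomb G bs cs \<otimes> inv lincomb G bs ds"
  using assms(2,1)
proof (induction cs ds arbitrary: bs rule: list_induct2)
  case (Cons c cs d ds)
  show ?case
  proof (cases bs)
    case [simp]: (Cons b bs')
    have b: "b \<in> carrier G" "set bs' \<subseteq> carrier G" using Cons.prems by auto
    show ?thesis using b Cons.IH[OF b(2)]
      by (simp add: int_pow_diff inv_mult m_ac)
  qed simp
qed (cases bs; simp)

lemma lincomb_scale:
  assumes "set bs \<subseteq> carrier G"
  shows "lincomb G bs (map (\<lambda>c. c * e) cs) = lincomb G bs cs [^] (e :: int)"
  using assms
proof (induction bs arbitrary: cs)
  case (Cons b bs)
  then show ?case by (cases cs) (auto simp: int_pow_pow int_pow_distrib)
qed auto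

lemma int_pow_mod_exponent:
  assumes "x \<in> carrier G" "x [^] p = \<one>"
  shows "x [^] (c mod p) = x [^] (c :: int)"
proof -
  have "x [^] c = x [^] (p * (c div p) + c mod p)" by simp
  also have "\<dots> = x [^] (p * (c div p)) \<otimes> x [^] (c mod p)"
    using assms(1) by (rule int_pow_mult)
  also have "x [^] (p * (c div p)) = \<one>"
    using assms by (simp flip: int_pow_pow)
  finally show ?thesis using assms(1) by simp
qed

lemma lincomb_mod:
  assumes "set bs \<subseteq> carrier G" "\<And>x. x \<in> carrier G \<Longrightarrow> x [^] p = \<one>"
  shows "lincomb G bs (map (\<lambda>c. c mod p) cs) = lincomb G bs (cs :: int list)"
  using assms(1)
proof (induction bs arbitrary: cs)
  case (Cons b bs)
  then show ?case by (cases cs) (auto simp: int_pow_mod_exponent assms(2))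
qed auto

definition independent :: "int \<Rightarrow> 'a list \<Rightarrow> bool" where
  "independent p bs \<longleftrightarrow>
     (\<forall>cs. length cs = length bs \<longrightarrow> lincomb G bs cs = \<one> \<longrightarrow> (\<forall>c\<in>set cs. p dvd c))"

lemma independent_differenceD:
  assumes "independent p bs" "set bs \<subseteq> carrier G"
    and "length cs = length bs" "length cs' = length bs"
    and "length ds = length bs" "length ds' = length bs"
    and eq: "lincomb G bs cs \<otimes> inv lincomb G bs cs' = lincomb G bs ds \<otimes> inv lincomb G bs ds'"
  shows "\<forall>c\<in>set (map2 (-) (map2 (-) cs cs') (map2 (-) ds ds')). p dvd c"
proof -
  have "lincomb G bs (map2 (-) (map2 (-) cs cs') (map2 (-) ds ds')) = \<one>"
    using assms by (simp add: lincomb_diff)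
  then show ?thesis using assms unfolding independent_def by (metis length_map length_zip min.idem)
qed

text \<open>
  A relation with leading coefficient prime to \<open>p\<close> can be solved for \<open>b\<close> by a Bezout identity,
  which would put \<open>b\<close> in the span of \<open>bs\<close>; reduction modulo the exponent keeps that span the image
  of a finite box of coefficient vectors.
\<close>
lemma independent_extend:
  fixes p :: int
  assumes p: "prime p" and exp: "\<And>x. x \<in> carrier G \<Longrightarrow> x [^] p = \<one>"
    and bs: "set bs \<subseteq> carrier G" "independent p bs" and b: "b \<in> carrier G"
    and new: "b \<notin> lincomb G bs ` {cs. set cs \<subseteq> {0..<p} \<and> length cs = length bs}"
  shows "independent p (b # bs)"
  unfolding independent_def
proof (intro allI impI)
  fix ccs :: "int list"
  assume "length ccs = length (b # bs)" and zero: "lincomb G (b # bs) ccs = \<one>"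
  then obtain c cs where ccs: "ccs = c # cs" and len: "length cs = length bs"
    by (cases ccs) auto
  have eq: "b [^] c \<otimes> lincomb G bs cs = \<one>" using zero ccs by simp
  have "p dvd c"
  proof (rule ccontr)
    assume "\<not> p dvd c"
    then have "coprime c p" using p by (metis coprime_commute prime_imp_coprime)
    then obtain d e where de: "d * c + e * p = 1"
      by (metis bezout_int coprime_iff_gcd_eq_1)
    define f where "f = - d"
    have "lincomb G bs cs = inv (b [^] c)"
      using eq b bs(1) by (metis int_pow_closed inv_equality inv_inv lincomb_closed m_comm)
    then have "lincomb G bs (map (\<lambda>x. x * f) cs) = (b [^] (- c)) [^] f"
      using b bs(1) by (simp add: lincomb_scale int_pow_neg)
    also have "\<dots> = b [^] (d * c)" using b by (simp add: int_pow_pow f_def mult.commute)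
    also have "\<dots> = b [^] (d * c mod p)" using b exp by (simp add: int_pow_mod_exponent)
    also have "d * c mod p = 1 mod p" using de by (metis mod_mult_self1 mult.commute)
    also have "b [^] (1 mod p) = b" using b exp by (simp add: int_pow_mod_exponent)
    finally have "b = lincomb G bs (map (\<lambda>x. x mod p) (map (\<lambda>x. x * f) cs))"
      by (simp only: lincomb_mod[OF bs(1) exp])
    moreover have "set (map (\<lambda>x. x mod p) (map (\<lambda>x. x * f) cs)) \<subseteq> {0..<p}"
      using prime_gt_0_int[OF p] by auto
    ultimately show False using new len by auto
  qed
  moreover from this have "b [^] c = \<one>" 
    using int_pow_mod_exponent[OF b exp[OF b], of c] by simp
  then have "lincomb G bs cs = \<one>" using eq bs(1) by simp
  then have "\<forall>c\<in>set cs. p dvd c" using bs(2) len by (simp add: independent_def)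
  ultimately show "\<forall>c\<in>set ccs. p dvd c" by (simp add: ccs)
qed

text \<open>
  As long as fewer than \<open>k\<close> elements are chosen, the \<open>p\<^sup>m < p\<^sup>k\<close> combinations with reduced
  coefficients cannot exhaust the group, so an independent family can be extended.
\<close>
lemma elementary_abelian_basis:
  fixes p :: int
  assumes p: "prime p" and exp: "\<And>x. x \<in> carrier G \<Longrightarrow> x [^] p = \<one>"
    and card: "order G = nat p ^ k"
  shows "\<exists>bs. length bs = k \<and> set bs \<subseteq> carrier G \<and> independent p bs"
proof -
  have "\<exists>bs. length bs = m \<and> set bs \<subseteq> carrier G \<and> independent p bs" if "m \<le> k" for m
    using that
  proof (induction m)
    case 0
    then show ?case by (simp add: independent_def)
  next
    case (Suc m)
    then obtain bs where bs: "length bs = m" "set bs \<subseteq> carrier G" "independent p bs" by auto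
    let ?S = "lincomb G bs ` {cs. set cs \<subseteq> {0..<p} \<and> length cs = length bs}"
    have fin: "finite ?S" by (simp add: finite_lists_length_eq)
    have "card ?S \<le> card {cs. set cs \<subseteq> {0..<p} \<and> length cs = length bs}"
      by (rule card_image_le) (simp add: finite_lists_length_eq)
    also have "\<dots> = nat p ^ m" by (simp add: card_lists_length_eq bs(1))
    also have "\<dots> < nat p ^ k"
      using Suc.prems prime_gt_1_int[OF p] by (intro power_strict_increasing) auto
    finally have "card ?S < card (carrier G)" using card by (simp add: order_def)
    then have "\<not> carrier G \<subseteq> ?S" using card_mono[OF fin, of "carrier G"] by linarith
    then obtain b where "b \<in> carrier G" "b \<notin> ?S" by blast
    then have "independent p (b # bs)"
      using independent_extend[OF p exp bs(2,3)] by blast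
    then show ?case using bs \<open>b \<in> carrier G\<close> by (intro exI[of _ "b # bs"]) auto
  qed
  then show ?thesis by blast
qed

end

text \<open>
  Lagrange's theorem gives \<open>p\<^sup>k \<cdot> 1 = 0\<close>; as \<open>p\<^sup>k \<cdot> 1 = (p \<cdot> 1)\<^sup>k\<close> and there are no zero divisors,
  already \<open>p \<cdot> 1 = 0\<close>.
\<close>
lemma (in domain) characteristic_kills:
  assumes card: "order R = p ^ k" and x: "x \<in> carrier R"
  shows "add_pow R p x = \<zero>"
proof -
  let ?c = "add_pow R p \<one>"
  have pow: "add_pow R (p ^ i) \<one> = ?c [^] i" for i
  proof (induction i)
    case (Suc i)
    have "?c [^] Suc i = add_pow R (p ^ i) \<one> \<otimes> ?c" by (simp add: Suc)
    also have "\<dots> = add_pow R (p ^ i) ?c"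
      using add_pow_ldistr[of \<one> ?c "p ^ i"] by simp
    also have "\<dots> = add_pow R (p * p ^ i) \<one>"
      by (rule add.nat_pow_pow) simp
    finally show ?case by (simp only: power_Suc)
  qed simp
  have "add_pow R (order R) \<one> = \<zero>"
    using add.pow_order_eq_1[OF one_closed] by (simp add: order_def)
  then have "?c [^] k = \<zero>" by (simp add: card pow)
  then have "?c = \<zero>"
  proof (induction k)
    case (Suc k)
    then show ?case using integral[of "?c [^] k" ?c] by auto
  qed simp
  then show ?thesis using add_pow_ldistr[OF one_closed x, of p] x by simp
qed

lemma (in domain) additive_basis:
  assumes "prime (int p)" "order R = p ^ k"
  shows "\<exists>bs. length bs = k \<and> set bs \<subseteq> carrier R \<and> comm_group.independent (add_monoid R) (int p) bs"
proof -
  have "order (add_monoid R) = nat (int p) ^ k"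
    using assms(2) by (simp add: order_def)
  moreover have "x [^]\<^bsub>add_monoid R\<^esub> int p = \<one>\<^bsub>add_monoid R\<^esub>"
    if "x \<in> carrier (add_monoid R)" for x
    using characteristic_kills[OF assms(2)] that
    by (simp add: int_pow_int add_pow_def)
  ultimately show ?thesis
    using comm_group.elementary_abelian_basis[OF a_comm_group assms(1)] by simp
qed

section \<open>Difference matrices by injectivity\<close>

text \<open>
  With as many columns as group elements, an injective difference map is a bijection and attains
  each element once.  Pairs \<open>t < s\<close> suffice, because exchanging the rows inverts every difference.
\<close>
lemma difference_matrixI:
  assumes G: "comm_group G" and order: "order G = n" "0 < n" and "2 \<le> k"
    and closed: "\<And>i j. i < k \<Longrightarrow> j < n \<Longrightarrow> D i j \<in> carrier G"
    and inj: "\<And>s t. t < s \<Longrightarrow> s < k \<Longrightarrow> inj_on (\<lambda>j. D s j \<otimes>\<^bsub>G\<^esub> inv\<^bsub>G\<^esub> D t j) {..<n}"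
  shows "difference_matrix G n k D"
proof -
  interpret comm_group G by fact
  have fin: "finite (carrier G)" using order by (metis order_gt_0_iff_finite)
  have "count {# D s j \<otimes>\<^bsub>G\<^esub> inv\<^bsub>G\<^esub> D t j. j \<in># mset_set {..<n} #} g = 1"
    if st: "s < k" "t < k" "s \<noteq> t" and g: "g \<in> carrier G" for s t g
  proof -
    let ?f = "\<lambda>j. D s j \<otimes>\<^bsub>G\<^esub> inv\<^bsub>G\<^esub> D t j"
    have inj_st: "inj_on ?f {..<n}"
    proof (cases "t < s")
      case False
      let ?g = "\<lambda>j. D t j \<otimes>\<^bsub>G\<^esub> inv\<^bsub>G\<^esub> D s j"
      have f: "?f j = inv\<^bsub>G\<^esub> ?g j" if "j < n" for j
        using st closed that by (simp add: inv_mult m_comm)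
      have "inj_on ?g {..<n}" using inj[of s t] st False by auto
      moreover have "?g j \<in> carrier G" if "j < n" for j using st closed that by simp
      ultimately show ?thesis
        unfolding inj_on_def using f by (metis inv_inv lessThan_iff)
    qed (use inj st in auto)
    have "?f ` {..<n} = carrier G"
      using st closed card_image[OF inj_st] order
      by (intro card_subset_eq[OF fin]) (auto simp: order_def)
    then show ?thesis using inj_st fin g by (simp add: image_mset_mset_set)
  qed
  then show ?thesis
    using assms(1,2,4) fin closed by (auto simp: difference_matrix_def)
qed

section \<open>Twelve base columns and their translates\<close>

type_synonym triple = "int \<times> int \<times> int"

fun scale :: "int \<Rightarrow> triple \<Rightarrow> triple" where
  "scale h (a, b, c) = (h * a, h * b, h * c)"

text \<open>
  Triples are coefficient vectors in ascending order of degree, and \<open>x\<^sup>3 = x + 1\<close>.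
\<close>
fun times_x :: "triple \<Rightarrow> triple" where
  "times_x (a, b, c) = (c, a + c, b)"

fun cross :: "triple \<Rightarrow> triple \<Rightarrow> triple" where
  "cross (a, b, c) (d, e, f) = (b * f - c * e, c * d - a * f, a * e - b * d)"

fun dot :: "triple \<Rightarrow> triple \<Rightarrow> int" where
  "dot (a, b, c) (d, e, f) = a * d + b * e + c * f"

fun zero_mod3 :: "triple \<Rightarrow> bool" where
  "zero_mod3 (a, b, c) \<longleftrightarrow> 3 dvd a \<and> 3 dvd b \<and> 3 dvd c"

text \<open>The ring elements \<open>a\<^sub>s\<close> by which the translations by \<open>W\<close> are multiplied in the ten rows.\<close>
definition points :: "triple list" where
  "points = [(0, 0, 0), (1, 2, 1), (2, 2, 1), (1, 0, 2), (0, 2, 0),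
    (0, 0, 2), (0, 1, 1), (1, 1, 0), (1, 1, 2), (2, 2, 2)]"

text \<open>
  Ten rows of a generalized Hadamard matrix of order 12 over the Klein four-group, whose element with
  coordinates \<open>(y div 2, y mod 2)\<close> is written as the number \<open>y < 4\<close>.
\<close>
definition quaternary_part :: "int list list" where
  "quaternary_part = [
    [0, 0, 0, 0, 0, 0, 0, 0, 0, 0, 0, 0],
    [0, 0, 0, 1, 1, 1, 2, 2, 2, 3, 3, 3],
    [0, 0, 2, 0, 2, 3, 1, 1, 3, 3, 1, 2],
    [0, 1, 0, 3, 2, 2, 3, 1, 0, 2, 3, 1],
    [0, 1, 2, 2, 3, 1, 2, 3, 3, 0, 0, 1],
    [0, 1, 3, 2, 0, 3, 1, 2, 0, 1, 2, 3],
    [0, 2, 1, 0, 3, 2, 3, 2, 1, 0, 1, 3],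
    [0, 2, 1, 3, 1, 3, 1, 3, 2, 2, 0, 0],
    [0, 3, 2, 1, 1, 2, 3, 0, 3, 1, 2, 0],
    [0, 3, 3, 3, 0, 1, 2, 0, 1, 2, 1, 2]]"

text \<open>
  A solution of the system of linear equations and non-vanishing conditions that belongs to
  \<open>quaternary_part\<close> and \<open>points\<close>.  Adding a constant triple to all entries of a row or of a column
  leads to another solution, so the first row and the last column can be normalized to zero.
\<close>
definition ternary_part :: "triple list list" where
  "ternary_part = [
    [(0, 0, 0), (0, 0, 0), (0, 0, 0), (0, 0, 0), (0, 0, 0), (0, 0, 0),
     (0, 0, 0), (0, 0, 0), (0, 0, 0), (0, 0, 0), (0, 0, 0), (0, 0, 0)],
    [(0, 1, 2), (1, 1, 0), (2, 1, 2), (1, 2, 0), (2, 2, 1), (0, 2, 2),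
     (1, 0, 0), (1, 2, 0), (1, 1, 0), (0, 2, 0), (0, 1, 2), (0, 0, 0)],
    [(2, 2, 1), (0, 0, 1), (0, 2, 2), (0, 2, 2), (2, 1, 2), (1, 1, 1),
     (1, 1, 2), (2, 0, 0), (0, 1, 1), (0, 0, 0), (1, 2, 0), (0, 0, 0)],
    [(2, 1, 2), (0, 1, 2), (2, 0, 2), (0, 0, 2), (1, 1, 2), (0, 2, 2),
     (2, 2, 2), (0, 2, 1), (1, 2, 0), (1, 0, 2), (0, 1, 1), (0, 0, 0)],
    [(1, 1, 1), (2, 0, 2), (2, 0, 2), (1, 2, 0), (0, 2, 1), (1, 2, 2),
     (0, 2, 1), (1, 2, 1), (2, 1, 1), (2, 2, 0), (0, 1, 1), (0, 0, 0)],
    [(2, 1, 0), (0, 1, 2), (2, 0, 0), (0, 0, 2), (1, 1, 0), (0, 2, 0),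
     (2, 2, 1), (0, 2, 0), (1, 2, 2), (1, 0, 2), (0, 1, 0), (0, 0, 0)],
    [(2, 1, 1), (1, 2, 0), (0, 2, 1), (2, 1, 2), (0, 1, 0), (1, 0, 0),
     (0, 2, 0), (2, 1, 0), (1, 0, 1), (2, 1, 0), (1, 1, 1), (0, 0, 0)],
    [(0, 2, 1), (2, 2, 2), (2, 1, 1), (1, 0, 1), (1, 1, 0), (2, 1, 0),
     (0, 0, 1), (2, 0, 1), (2, 1, 2), (2, 0, 2), (1, 1, 1), (0, 0, 0)],
    [(2, 0, 2), (0, 0, 2), (0, 1, 2), (2, 0, 2), (1, 2, 2), (2, 2, 1),
     (0, 0, 1), (1, 2, 1), (0, 1, 0), (2, 1, 0), (2, 0, 2), (0, 0, 0)],
    [(2, 1, 2), (0, 0, 2), (2, 0, 0), (0, 0, 0), (0, 0, 1), (0, 0, 0),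
     (1, 0, 2), (1, 0, 0), (1, 1, 0), (2, 2, 1), (0, 2, 1), (0, 0, 0)]]"

text \<open>
  The name of the coset of \<open>0 \<times> (a\<^sub>s - a\<^sub>t) W\<close> that contains the difference of rows \<open>s\<close> and \<open>t\<close> in
  base column \<open>m\<close>: the scalar product with a normal vector of the plane \<open>(a\<^sub>s - a\<^sub>t) W\<close> is constant
  modulo 3 on the cosets of this plane.
\<close>
definition residue_key :: "nat \<Rightarrow> nat \<Rightarrow> nat \<Rightarrow> int \<times> int \<times> int" where
  "residue_key s t m =
     (let y = quaternary_part ! s ! m; y' = quaternary_part ! t ! m;
          u = points ! s - points ! t
      in ((y div 2 - y' div 2) mod 2, (y mod 2 - y' mod 2) mod 2,
          dot (cross u (times_x u)) (ternary_part ! s ! m - ternary_part ! t ! m) mod 3))"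

text \<open>
  The normal vector does not vanish because multiplication by \<open>a\<^sub>s - a\<^sub>t \<noteq> 0\<close> preserves the
  independence of \<open>1\<close> and \<open>x\<close>; that the 12 names are distinct is the property of the tables.
\<close>
lemma base_columns:
  assumes "t < s" "s < 10"
  defines "u \<equiv> points ! s - points ! t"
  shows "\<not> zero_mod3 (cross u (times_x u))" "distinct (map (residue_key s t) [0..<12])"
proof -
  have "\<forall>s\<in>set [0..<10]. \<forall>t\<in>set [0..<s].
      \<not> zero_mod3 (cross (points ! s - points ! t) (times_x (points ! s - points ! t))) \<and>
      distinct (map (residue_key s t) [0..<12])"
    by code_simp
  moreover have "s \<in> set [0..<10]" "t \<in> set [0..<s]" using assms by simp_all
  ultimately show "\<not> zero_mod3 (cross u (times_x u))"
      "distinct (map (residue_key s t) [0..<12])"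
    unfolding u_def by blast+
qed

text \<open>
  Column \<open>j = 9m + 3h + i\<close> is the translate of base column \<open>m\<close> by \<open>w = h + ix\<close>.
\<close>
definition quaternary_entry :: "nat \<Rightarrow> nat \<Rightarrow> int list" where
  "quaternary_entry s j = (let y = quaternary_part ! s ! (j div 9) in [y div 2, y mod 2])"

definition ternary_entry :: "nat \<Rightarrow> nat \<Rightarrow> triple" where
  "ternary_entry s j = ternary_part ! s ! (j div 9)
     + scale (int (j div 3 mod 3)) (points ! s) + scale (int (j mod 3)) (times_x (points ! s))"

lemma cross_kills:
  "dot (cross u v) (x + scale h u + scale i v) = dot (cross u v) x"
  by (cases u; cases v; cases x) (simp add: algebra_simps)

lemma dot_zero_mod3: "zero_mod3 x \<Longrightarrow> 3 dvd dot w x"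
  by (cases x; cases w) simp

text \<open>
  Crossing \<open>h u + i v\<close> with \<open>v\<close> leaves \<open>h\<close> times the cross product, and likewise for \<open>i\<close>; some
  component of the cross product is invertible modulo 3.
\<close>
lemma cross_nonzero_imp_independent:
  assumes "zero_mod3 (scale h u + scale i v)" "\<not> zero_mod3 (cross u v)"
  shows "3 dvd h" "3 dvd i"
proof -
  have prime3: "prime (3 :: int)" by simp
  obtain a b c d e f where [simp]: "u = (a, b, c)" "v = (d, e, f)" by (metis prod_cases3)
  have z: "3 dvd h * a + i * d" "3 dvd h * b + i * e" "3 dvd h * c + i * f"
    using assms(1) by simp_all
  have comb: "3 dvd r * p - s * q" if "3 dvd p" "3 dvd q" for r s p q :: int
    using that by auto
  have "3 dvd h * (b * f - c * e)" "3 dvd h * (c * d - a * f)" "3 dvd h * (a * e - b * d)"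
    using comb[OF z(2) z(3), of f e] comb[OF z(3) z(1), of d f] comb[OF z(1) z(2), of e d]
    by (simp_all add: algebra_simps)
  then show "3 dvd h" using assms(2) prime_dvd_multD[OF prime3] by fastforce
  have "3 dvd i * (b * f - c * e)" "3 dvd i * (c * d - a * f)" "3 dvd i * (a * e - b * d)"
    using comb[OF z(3) z(2), of b c] comb[OF z(1) z(3), of c a] comb[OF z(2) z(1), of a b]
    by (simp_all add: algebra_simps)
  then show "3 dvd i" using assms(2) prime_dvd_multD[OF prime3] by fastforce
qed

text \<open>
  If the differences of two columns agree, then so do the names of their cosets, hence the base
  columns coincide; the rest of the difference is a combination of \<open>u\<close> and \<open>xu\<close>, whose independence
  modulo 3 makes the translations coincide too.
\<close>
lemma entries_injective:
  assumes st: "t < s" "s < 10" and j: "j < 108" "j' < 108"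
    and two: "\<forall>c\<in>set (map2 (-) (map2 (-) (quaternary_entry s j) (quaternary_entry t j))
                            (map2 (-) (quaternary_entry s j') (quaternary_entry t j'))). 2 dvd c"
    and three: "zero_mod3 ((ternary_entry s j - ternary_entry t j)
                         - (ternary_entry s j' - ternary_entry t j'))"
  shows "j = j'"
proof -
  define u where "u = points ! s - points ! t"
  let ?v = "times_x u"
  let ?x = "\<lambda>j. ternary_part ! s ! (j div 9) - ternary_part ! t ! (j div 9)"
  let ?h = "int (j div 3 mod 3) - int (j' div 3 mod 3)" and ?i = "int (j mod 3) - int (j' mod 3)"
  have diff: "(ternary_entry s j - ternary_entry t j) - (ternary_entry s j' - ternary_entry t j')
      = (?x j - ?x j') + scale ?h u + scale ?i ?v"
    unfolding ternary_entry_def u_def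
    by (cases "points ! s"; cases "points ! t"; cases "ternary_part ! s ! (j div 9)";
        cases "ternary_part ! s ! (j' div 9)"; cases "ternary_part ! t ! (j div 9)";
        cases "ternary_part ! t ! (j' div 9)") (simp add: algebra_simps)
  have check: "\<not> zero_mod3 (cross u ?v)" "distinct (map (residue_key s t) [0..<12])"
    unfolding u_def by (rule base_columns[OF st])+
  have "3 dvd dot (cross u ?v) (?x j - ?x j')"
    using dot_zero_mod3[OF three, where w = "cross u ?v"] by (simp only: diff cross_kills)
  also have "dot (cross u ?v) (?x j - ?x j') = dot (cross u ?v) (?x j) - dot (cross u ?v) (?x j')"
    by (cases "cross u ?v"; cases "?x j"; cases "?x j'") (simp add: algebra_simps)
  finally have key: "residue_key s t (j div 9) = residue_key s t (j' div 9)"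
    using two by (simp add: residue_key_def quaternary_entry_def Let_def mod_eq_dvd_iff u_def)
  have inj: "inj_on (residue_key s t) (set [0..<12])"
    using check(2) by (simp only: distinct_map)
  have "j div 9 \<in> set [0..<12]" "j' div 9 \<in> set [0..<12]"
    using j unfolding set_upt by auto
  with inj_onD[OF inj key] have m: "j div 9 = j' div 9" by blast
  then have "zero_mod3 (scale ?h u + scale ?i ?v)"
    using three by (simp add: diff)
  then have "3 dvd ?h" "3 dvd ?i"
    using cross_nonzero_imp_independent check(1) by blast+
  have digit: "a mod 3 = b mod 3" if "3 dvd int (a mod 3) - int (b mod 3)" for a b
    using that by presburger
  have "j div 3 mod 3 = j' div 3 mod 3" "j mod 3 = j' mod 3"
    using digit \<open>3 dvd ?h\<close> \<open>3 dvd ?i\<close> by blast+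
  moreover have "j div 3 div 3 = j' div 3 div 3"
    using m by (simp flip: div_mult2_eq)
  ultimately show ?thesis by (metis div_mult_mod_eq)
qed

section \<open>The difference matrix\<close>

theorem mainTheorem4:
  fixes K :: "('a, 'm) ring_scheme" and L :: "('b, 'n) ring_scheme"
  assumes "field K" and "order K = 4"
    and "field L" and "order L = 27"
  shows "\<exists>D. difference_matrix (add_monoid (RDirProd K L)) 108 10 D"
proof -
  interpret K: field K by fact
  interpret L: field L by fact
  let ?A = "add_monoid K" and ?B = "add_monoid L"
  have A: "comm_group ?A" and B: "comm_group ?B" by (rule K.a_comm_group L.a_comm_group)+
  interpret P: ring "RDirProd K L" by (rule RDirProd_ring) unfold_locales
  obtain bs where bs: "length bs = 2" "set bs \<subseteq> carrier ?A" "comm_group.independent ?A 2 bs"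
    using K.additive_basis[of 2 2] assms(2) by auto
  obtain cs where cs: "length cs = 3" "set cs \<subseteq> carrier ?B" "comm_group.independent ?B 3 cs"
    using L.additive_basis[of 3 3] assms(4) by auto
  define Q where "Q s j = lincomb ?A bs (quaternary_entry s j)" for s j
  define coords where "coords x = (case x of (a, b, c) \<Rightarrow> [a, b, c])" for x :: triple
  define T where "T s j = lincomb ?B cs (coords (ternary_entry s j))" for s j
  have Q: "Q s j \<in> carrier ?A" and T: "T s j \<in> carrier ?B" for s j
    unfolding Q_def T_def using bs(2) cs(2)
    by (blast intro: comm_group.lincomb_closed[OF A] comm_group.lincomb_closed[OF B])+
  have "difference_matrix (?A \<times>\<times> ?B) 108 10 (\<lambda>s j. (Q s j, T s j))"
  proof (rule difference_matrixI)
    show "comm_group (?A \<times>\<times> ?B)" using P.a_comm_group by (simp only: RDirProd_add_monoid)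
    show "order (?A \<times>\<times> ?B) = 108" using assms(2,4) by (simp add: order_def card_cartesian_product)
    fix s t :: nat assume st: "t < s" "s < 10"
    show "inj_on (\<lambda>j. (Q s j, T s j) \<otimes>\<^bsub>?A \<times>\<times> ?B\<^esub> inv\<^bsub>?A \<times>\<times> ?B\<^esub> (Q t j, T t j)) {..<108}"
    proof (rule inj_onI)
      fix j j' assume j: "j \<in> {..<108}" "j' \<in> {..<108::nat}"
        and "(Q s j, T s j) \<otimes>\<^bsub>?A \<times>\<times> ?B\<^esub> inv\<^bsub>?A \<times>\<times> ?B\<^esub> (Q t j, T t j)
           = (Q s j', T s j') \<otimes>\<^bsub>?A \<times>\<times> ?B\<^esub> inv\<^bsub>?A \<times>\<times> ?B\<^esub> (Q t j', T t j')"
      then have eq: "Q s j \<otimes>\<^bsub>?A\<^esub> inv\<^bsub>?A\<^esub> Q t j = Q s j' \<otimes>\<^bsub>?A\<^esub> inv\<^bsub>?A\<^esub> Q t j'"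
          "T s j \<otimes>\<^bsub>?B\<^esub> inv\<^bsub>?B\<^esub> T t j = T s j' \<otimes>\<^bsub>?B\<^esub> inv\<^bsub>?B\<^esub> T t j'"
        using inv_DirProd[OF comm_group.axioms(2)[OF A] comm_group.axioms(2)[OF B] Q T]
        by (simp_all only: mult_DirProd prod.inject)
      have two: "\<forall>c\<in>set (map2 (-) (map2 (-) (quaternary_entry s j) (quaternary_entry t j))
                            (map2 (-) (quaternary_entry s j') (quaternary_entry t j'))). 2 dvd c"
        by (rule comm_group.independent_differenceD[OF A bs(3,2) _ _ _ _ eq(1)[unfolded Q_def]])
           (simp_all add: quaternary_entry_def bs(1) Let_def)
      have coords: "length (coords x) = length cs"
        "zero_mod3 ((x - y) - (x' - y')) \<longleftrightarrow>
           (\<forall>c\<in>set (map2 (-) (map2 (-) (coords x) (coords y)) (map2 (-) (coords x') (coords y'))). 3 dvd c)"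
        for x y x' y'
        by (cases x; cases y; cases x'; cases y'; simp add: coords_def cs(1))+
      have "zero_mod3 ((ternary_entry s j - ternary_entry t j)
                     - (ternary_entry s j' - ternary_entry t j'))"
        unfolding coords(2)
        by (rule comm_group.independent_differenceD[OF B cs(3,2) _ _ _ _ eq(2)[unfolded T_def]])
           (rule coords(1))+
      then show "j = j'" using entries_injective[OF st _ _ two] j by simp
    qed
  next
    show "(Q s j, T s j) \<in> carrier (?A \<times>\<times> ?B)" for s j
      using Q T by (simp only: carrier_DirProd mem_Times_iff fst_conv snd_conv)
  qed simp_all
  then show ?thesis unfolding RDirProd_add_monoid by blast
qed

end
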